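(* Let $\Gamma_1$ and $\Gamma_2$ be cones of $\mathbb{R}^2$ such that $\Gamma_1\cap(-\Gamma_2)=\emptyset$. Then there exists $C>0$ such that $$\operatorname{card}\{k\in\mathbb{Z}^2: n-k\in\Gamma_1\text{ and }k\in\Gamma_2\}\leq C|n|^{2},\qquad n\in\mathbb{Z}^2.$$
   Context: $|\cdot|$ is the Euclidean norm. A cone is a subset of $\mathbb{R}^2$ closed under multiplication by positive scalars.
   Formalization: Both cones are additionally assumed closed in the plane without the origin; for arbitrary cones the claim fails: with the half-planes y > 0 and y ≥ 0 and n = (0,1), every k = (a,0) is counted, so the set is infinite. *)

theory Defs
  imports "HOL-Analysis.Analysis"
begin

(* Unlike the library's cone and conic, only strictly positive scalars are used,
   so a nonempty cone need not contain the origin. *)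
definition pos_cone :: "(real^2) set \<Rightarrow> bool" where
  "pos_cone \<Gamma> \<longleftrightarrow> (\<forall>x\<in>\<Gamma>. \<forall>t>0. t *\<^sub>R x \<in> \<Gamma>)"

definition lattice2 :: "(real^2) set" where
  "lattice2 = {x. \<forall>i. x $ i \<in> \<int>}"

(* The convention of microlocal analysis: closed as a subset of the plane without
   the origin, whether or not the origin itself belongs to the set. Closedness in
   the whole plane would be vacuous here: a nonempty closed cone contains the origin,
   so no two nonempty closed cones G1, G2 satisfy that G1 and -G2 are disjoint.
   Without closedness the lattice point count may be infinite: take the half-planes
   y > 0 and y >= 0, and n = (0,1); then every k = (a,0) is counted. *)
definition closed_off_origin :: "(real^2) set \<Rightarrow> bool" where
  "closed_off_origin \<Gamma> \<longleftrightarrow> closedin (top_of_set (- {0})) (\<Gamma> - {0})"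

end

theory Submission
  imports Defs
begin

text \<open>
  The hypothesis says that no vector of \<open>\<Gamma>1\<close> is opposite to a vector of \<open>\<Gamma>2\<close>. Since both
  cones are closed away from the origin, compactness of the unit sphere upgrades this to a
  uniform angle: the unit vectors of \<open>\<Gamma>2\<close> stay at a distance \<open>d > 0\<close> from \<open>-\<Gamma>1\<close>, so by
  homogeneity there is no cancellation in a sum, that is, \<open>d * norm y \<le> norm (x + y)\<close> for
  \<open>x \<in> \<Gamma>1\<close> and \<open>y \<in> \<Gamma>2\<close> (lemma \<open>cone_sum_norm_lower_bound\<close>). With \<open>x = n - k\<close> and
  \<open>y = k\<close>, every counted \<open>k\<close> lies in the disc of radius \<open>norm n / d\<close>, which contains at most
  \<open>(2 * norm n / d + 1)\<^sup>2\<close> lattice points (lemma \<open>lattice2_cball\<close>). For \<open>n \<noteq> 0\<close> the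
  additive 1 is absorbed because a nonzero lattice vector has norm at least 1. For \<open>n = 0\<close>
  nothing is counted, because \<open>-k \<in> \<Gamma>1\<close> and \<open>k \<in> \<Gamma>2\<close> is just what the disjointness
  forbids.
\<close>

lemma closed_insert_0:
  assumes "closed_off_origin \<Gamma>"
  shows "closed (insert 0 \<Gamma>)"
proof -
  obtain T where T: "closed T" "\<Gamma> - {0} = - {0} \<inter> T"
    using assms unfolding closed_off_origin_def closedin_closed by blast
  then have "insert 0 \<Gamma> = insert 0 T"
    by blast
  then show ?thesis
    using T(1) by simp
qed

text \<open>
  Only the second set has to be scaled to the unit sphere, where compactness is
  available; the first set, with the origin added, is merely a closed set that the unit
  vectors of \<open>-B\<close> avoid.
\<close>
lemma cone_sum_norm_lower_bound:
  fixes A B :: "'a::euclidean_space set"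
  assumes A: "\<And>x t. x \<in> A \<Longrightarrow> t > 0 \<Longrightarrow> t *\<^sub>R x \<in> A"
    and B: "\<And>x t. x \<in> B \<Longrightarrow> t > 0 \<Longrightarrow> t *\<^sub>R x \<in> B"
    and "closed (insert 0 A)" "closed (insert 0 B)"
    and disj: "A \<inter> uminus ` B = {}"
  obtains d where "d > 0" "\<And>x y. x \<in> A \<Longrightarrow> y \<in> B \<Longrightarrow> d * norm y \<le> norm (x + y)"
proof -
  let ?S = "sphere 0 1 \<inter> insert 0 B" and ?K = "uminus ` insert 0 A"
  have "compact ?S"
    using assms(4) by (intro compact_Int_closed) auto
  moreover have "closed ?K"
    using assms(3) by (rule closed_negations)
  moreover have "?S \<inter> ?K = {}"
    using disj by force
  ultimately obtain d where d: "d > 0" "\<And>v w. v \<in> ?S \<Longrightarrow> w \<in> ?K \<Longrightarrow> d \<le> dist v w"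
    using separate_compact_closed by metis
  have "d * norm y \<le> norm (x + y)" if "x \<in> A" "y \<in> B" for x y
  proof (cases "y = 0")
    case False
    let ?t = "inverse (norm y)"
    have "?t > 0"
      using False by simp
    then have "?t *\<^sub>R y \<in> ?S" "- (?t *\<^sub>R x) \<in> ?K"
      using A[OF that(1)] B[OF that(2)] False by auto
    then have "d \<le> dist (?t *\<^sub>R y) (- (?t *\<^sub>R x))"
      by (rule d(2))
    also have "\<dots> = norm (?t *\<^sub>R (x + y))"
      by (simp add: dist_norm scaleR_add_right add.commute)
    also have "\<dots> = norm (x + y) / norm y"
      by (simp add: divide_inverse mult.commute)
    finally show ?thesis
      using False by (simp add: pos_le_divide_eq)
  qed simp
  with d(1) show thesis
    by (rule that)
qed

lemma lattice2_cball:
  assumes "R \<ge> 0"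
  shows "finite (lattice2 \<inter> cball 0 R)"
    and "real (card (lattice2 \<inter> cball 0 R)) \<le> (2 * R + 1)\<^sup>2"
proof -
  let ?L = "lattice2 \<inter> cball 0 R" and ?I = "{- \<lfloor>R\<rfloor>..\<lfloor>R\<rfloor>}"
  let ?f = "\<lambda>k::real^2. (\<lfloor>k $ 1\<rfloor>, \<lfloor>k $ 2\<rfloor>)"
  have floor_eq: "of_int \<lfloor>k $ i\<rfloor> = k $ i" if "k \<in> lattice2" for k i
    using that by (simp add: lattice2_def)
  have inj: "inj_on ?f ?L"
  proof (rule inj_onI)
    fix k l assume "k \<in> ?L" "l \<in> ?L" "?f k = ?f l"
    then have "k $ 1 = l $ 1" "k $ 2 = l $ 2"
      using floor_eq by (metis IntD1 prod.inject)+
    then show "k = l"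
      by (simp add: vec_eq_iff forall_2)
  qed
  have "\<lfloor>k $ i\<rfloor> \<in> ?I" if "k \<in> ?L" for k i
  proof -
    have "\<bar>of_int \<lfloor>k $ i\<rfloor>\<bar> \<le> R"
      using that component_le_norm_cart[of k i] by (simp add: floor_eq)
    then have "\<bar>\<lfloor>k $ i\<rfloor>\<bar> \<le> \<lfloor>R\<rfloor>"
      by (simp add: le_floor_iff)
    then show ?thesis
      by auto
  qed
  then have sub: "?f ` ?L \<subseteq> ?I \<times> ?I"
    by blast
  show "finite ?L"
    using inj sub by (meson finite_SigmaI finite_atLeastAtMost_int inj_on_finite)
  have "card ?L \<le> card (?I \<times> ?I)"
    using inj sub by (intro card_inj_on_le) auto
  then have "real (card ?L) \<le> real (card (?I \<times> ?I))"
    by (rule of_nat_mono)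
  also have "\<dots> = (2 * of_int \<lfloor>R\<rfloor> + 1)\<^sup>2"
    using assms by (simp add: card_cartesian_product power2_eq_square)
  also have "\<dots> \<le> (2 * R + 1)\<^sup>2"
    using assms by (intro power_mono) auto
  finally show "real (card ?L) \<le> (2 * R + 1)\<^sup>2" .
qed

lemma lattice2_norm_ge_1:
  assumes "n \<in> lattice2" "n \<noteq> 0"
  shows "norm n \<ge> 1"
proof -
  obtain i where "n $ i \<noteq> 0"
    using assms(2) by (auto simp: vec_eq_iff)
  then have "1 \<le> \<bar>n $ i\<bar>"
    using assms(1) by (intro Ints_nonzero_abs_ge1) (auto simp: lattice2_def)
  also have "\<dots> \<le> norm n"
    by (rule component_le_norm_cart)
  finally show ?thesis .
qed

theorem mainTheorem4:
  fixes \<Gamma>1 \<Gamma>2 :: "(real^2) set"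
  assumes "pos_cone \<Gamma>1" and "pos_cone \<Gamma>2"
    and "closed_off_origin \<Gamma>1" and "closed_off_origin \<Gamma>2"
    and "\<Gamma>1 \<inter> uminus ` \<Gamma>2 = {}"
  shows "\<exists>C>0. \<forall>n\<in>lattice2.
           finite {k \<in> lattice2. n - k \<in> \<Gamma>1 \<and> k \<in> \<Gamma>2} \<and>
           real (card {k \<in> lattice2. n - k \<in> \<Gamma>1 \<and> k \<in> \<Gamma>2}) \<le> C * (norm n)\<^sup>2"
proof -
  obtain d where d: "d > 0"
    "\<And>x y. x \<in> \<Gamma>1 \<Longrightarrow> y \<in> \<Gamma>2 \<Longrightarrow> d * norm y \<le> norm (x + y)"
    using cone_sum_norm_lower_bound[of \<Gamma>1 \<Gamma>2] assms closed_insert_0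
    unfolding pos_cone_def by metis
  show ?thesis
  proof (intro exI[of _ "(2 / d + 1)\<^sup>2"] conjI ballI)
    show "(2 / d + 1)\<^sup>2 > 0"
      using d(1) by (intro zero_less_power add_pos_pos) auto
  next
    fix n :: "real^2" assume n: "n \<in> lattice2"
    let ?N = "{k \<in> lattice2. n - k \<in> \<Gamma>1 \<and> k \<in> \<Gamma>2}" and ?R = "norm n / d"
    have R: "?R \<ge> 0"
      using d(1) by simp
    have sub: "?N \<subseteq> lattice2 \<inter> cball 0 ?R"
    proof
      fix k assume k: "k \<in> ?N"
      then have "d * norm k \<le> norm n"
        using d(2)[of "n - k" k] by simp
      then show "k \<in> lattice2 \<inter> cball 0 ?R"
        using k d(1) by (simp add: pos_le_divide_eq mult.commute)
    qed
    show "finite ?N"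
      using sub lattice2_cball(1)[OF R] by (rule finite_subset)
    show "real (card ?N) \<le> (2 / d + 1)\<^sup>2 * (norm n)\<^sup>2"
    proof (cases "n = 0")
      case True
      then have "?N = {}"
        using assms(5) by force
      then show ?thesis
        by (simp only: card.empty) simp
    next
      case False
      have "real (card ?N) \<le> real (card (lattice2 \<inter> cball 0 ?R))"
        using card_mono[OF lattice2_cball(1)[OF R] sub] by simp
      also have "\<dots> \<le> (2 * ?R + 1)\<^sup>2"
        by (rule lattice2_cball(2)[OF R])
      also have "\<dots> \<le> (2 * ?R + norm n)\<^sup>2"
        using R lattice2_norm_ge_1[OF n False] by (intro power_mono) auto
      also have "\<dots> = (2 / d + 1)\<^sup>2 * (norm n)\<^sup>2"
        by (simp add: algebra_simps flip: power_mult_distrib)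
      finally show ?thesis .
    qed
  qed
qed

end
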